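(* Let $a$ be a non-negative even integer. Then for any integer $m$ satisfying $0\leq m\leq a$, we have $$\sum_{j=0}^{a+1}\left(\binom{a+2}{m+1}-\binom{a-j+1}{a-m+1}\right)T_{\mathcal{A}}(\{1\}^{j},2,\{1\}^{a-j+1})=(-1)^{m+1}\sum_{j=0}^{a-m}T_{\mathcal{A}}(\{1\}^{j},2,\{1\}^{a-j+1}).$$
   Context: Let $\mathcal{P}$ be the set of primes and $\mathcal{A}:=\prod_{p\in\mathcal{P}}(\mathbb{Z}/p\mathbb{Z})\big/\bigoplus_{p\in\mathcal{P}}(\mathbb{Z}/p\mathbb{Z})$, in which an element is determined by its components at all but finitely many primes. For positive integers $k_1,\ldots,k_r$, the finite multiple $T$-value is $$T_{\mathcal{A}}(k_1,\ldots,k_r):=\Bigl(2^r\sum_{\substack{0<m_1<\cdots<m_r<p\\ m_i\equiv i\ (\mathrm{mod}\ 2)}}\frac{1}{m_1^{k_1}\cdots m_r^{k_r}}\bmod p\Bigr)_{p\in\mathcal{P}}\in\mathcal{A}.$$ The symbol $\{c\}^n$ denotes the string $c,\ldots,c$ with $n$ repetitions (empty if $n=0$). Binomial coefficients $\binom{i}{m}$ are $0$ if $m>i$. *)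

theory Defs
  imports "HOL-Number_Theory.Number_Theory"
begin

section \<open>The product ring of all prime fields\<close>

text \<open>
  An element is a family of canonical representatives: a residue in \<open>{0..<p}\<close> for each prime
  \<open>p\<close>. Indices that are not prime carry no information and are set to \<open>0\<close>.
\<close>

typedef prime_prod = "{f :: nat \<Rightarrow> int. \<forall>p. if prime p then f p \<in> {0..<int p} else f p = 0}"
  morphisms component Abs_prime_prod
  by (rule exI[of _ "\<lambda>_. 0"]) (auto simp: prime_gt_0_nat)

setup_lifting type_definition_prime_prod

lift_definition reduce :: "(nat \<Rightarrow> int) \<Rightarrow> prime_prod"
  is "\<lambda>f p. if prime p then f p mod int p else 0"
  by (auto simp: prime_gt_0_nat)

lemma prime_prod_eqI:
  assumes "\<And>p. prime p \<Longrightarrow> component x p = component y p"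
  shows "x = y"
proof -
  have "component x p = component y p" for p
    using assms component[of x] component[of y] by (cases "prime p") auto
  then show ?thesis
    by (metis component_inject ext)
qed

lemma component_reduce: "prime p \<Longrightarrow> component (reduce f) p = f p mod int p"
  by transfer simp

lemma component_mod: "prime p \<Longrightarrow> component x p mod int p = component x p"
  using component[of x] by (auto dest!: spec[of _ p])

instantiation prime_prod :: comm_ring_1
begin

definition "0 = reduce (\<lambda>_. 0)"
definition "1 = reduce (\<lambda>_. 1)"
definition "x + y = reduce (\<lambda>p. component x p + component y p)"
definition "x - y = reduce (\<lambda>p. component x p - component y p)"
definition "- x = reduce (\<lambda>p. - component x p)"
definition "x * y = reduce (\<lambda>p. component x p * component y p)"

lemmas prime_prod_ring_defs =
  zero_prime_prod_def one_prime_prod_def plus_prime_prod_def minus_prime_prod_def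
  uminus_prime_prod_def times_prime_prod_def

instance
proof
  fix x y z :: prime_prod
  note [simp] = prime_prod_ring_defs component_reduce component_mod mod_simps
  show "x + y + z = x + (y + z)" by (rule prime_prod_eqI) (simp add: add.assoc)
  show "x + y = y + x" by (rule prime_prod_eqI) (simp add: add.commute)
  show "0 + x = x" by (rule prime_prod_eqI) simp
  show "- x + x = 0" by (rule prime_prod_eqI) simp
  show "x - y = x + - y" by (rule prime_prod_eqI) simp
  show "x * y * z = x * (y * z)" by (rule prime_prod_eqI) (simp add: mult.assoc)
  show "x * y = y * x" by (rule prime_prod_eqI) (simp add: mult.commute)
  show "1 * x = x" by (rule prime_prod_eqI) simp
  show "(x + y) * z = x * z + y * z" by (rule prime_prod_eqI) (simp add: distrib_right)
  have "component (0 :: prime_prod) 2 \<noteq> component 1 2" by simp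
  then show "(0 :: prime_prod) \<noteq> 1" by metis
qed

end

lemma component_zero [simp]: "component 0 p = 0"
  unfolding zero_prime_prod_def by transfer simp

lemma component_one: "prime p \<Longrightarrow> component 1 p = 1"
  by (simp add: one_prime_prod_def component_reduce prime_gt_Suc_0_nat)

lemma component_add:
  "prime p \<Longrightarrow> component (x + y) p = (component x p + component y p) mod int p"
  by (simp add: plus_prime_prod_def component_reduce)

lemma component_uminus: "prime p \<Longrightarrow> component (- x) p = (- component x p) mod int p"
  by (simp add: uminus_prime_prod_def component_reduce)

lemma component_mult:
  "prime p \<Longrightarrow> component (x * y) p = (component x p * component y p) mod int p"
  by (simp add: times_prime_prod_def component_reduce)

lemma component_nonprime: "\<not> prime p \<Longrightarrow> component x p = 0"
  using component[of x] by (auto dest: spec[of _ p])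


section \<open>The ring \<open>\<A>\<close>\<close>

definition direct_sum :: "prime_prod set" where
  "direct_sum = {x. finite {p. prime p \<and> component x p \<noteq> 0}}"

lemma direct_sum_zero: "0 \<in> direct_sum"
  by (simp add: direct_sum_def)

lemma direct_sum_add: "x \<in> direct_sum \<Longrightarrow> y \<in> direct_sum \<Longrightarrow> x + y \<in> direct_sum"
  unfolding direct_sum_def mem_Collect_eq
  by (rule finite_subset[where B = "{p. prime p \<and> component x p \<noteq> 0} \<union>
        {p. prime p \<and> component y p \<noteq> 0}"]) (auto simp: component_add)

lemma direct_sum_uminus: "x \<in> direct_sum \<Longrightarrow> - x \<in> direct_sum"
  unfolding direct_sum_def mem_Collect_eq
  by (rule finite_subset[where B = "{p. prime p \<and> component x p \<noteq> 0}"])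
    (auto simp: component_uminus)

lemma direct_sum_mult: "x \<in> direct_sum \<Longrightarrow> y * x \<in> direct_sum"
  unfolding direct_sum_def mem_Collect_eq
  by (rule finite_subset[where B = "{p. prime p \<and> component x p \<noteq> 0}"])
    (auto simp: component_mult)

lemma direct_sum_diff: "x \<in> direct_sum \<Longrightarrow> y \<in> direct_sum \<Longrightarrow> x - y \<in> direct_sum"
  using direct_sum_add[of x "- y"] direct_sum_uminus by simp

lemma one_notin_direct_sum: "1 \<notin> direct_sum"
proof -
  have "{p :: nat. prime p \<and> component 1 p \<noteq> 0} = {p. prime p}"
    by (auto simp: component_one)
  then show ?thesis
    by (simp add: direct_sum_def primes_infinite)
qed

definition direct_sum_rel :: "prime_prod \<Rightarrow> prime_prod \<Rightarrow> bool" where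
  "direct_sum_rel x y \<longleftrightarrow> x - y \<in> direct_sum"

quotient_type \<A> = prime_prod / direct_sum_rel
  morphisms rep_\<A> to_\<A>
proof (rule equivpI)
  show "reflp direct_sum_rel"
    by (simp add: reflp_def direct_sum_rel_def direct_sum_zero)
  show "symp direct_sum_rel"
    unfolding symp_def direct_sum_rel_def by (metis direct_sum_uminus minus_diff_eq)
  show "transp direct_sum_rel"
    unfolding transp_def direct_sum_rel_def
    by (metis direct_sum_add diff_add_cancel add_diff_eq)
qed

instantiation \<A> :: comm_ring_1
begin

lift_definition zero_\<A> :: \<A> is 0 .
lift_definition one_\<A> :: \<A> is 1 .

lift_definition plus_\<A> :: "\<A> \<Rightarrow> \<A> \<Rightarrow> \<A>" is "(+)"
  unfolding direct_sum_rel_def by (metis direct_sum_add add_diff_add)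

lift_definition minus_\<A> :: "\<A> \<Rightarrow> \<A> \<Rightarrow> \<A>" is "(-)"
  unfolding direct_sum_rel_def
proof -
  fix x x' y y' :: prime_prod
  assume "x - x' \<in> direct_sum" "y - y' \<in> direct_sum"
  then have "(x - x') - (y - y') \<in> direct_sum" by (rule direct_sum_diff)
  then show "x - y - (x' - y') \<in> direct_sum" by (simp add: algebra_simps)
qed

lift_definition uminus_\<A> :: "\<A> \<Rightarrow> \<A>" is uminus
  unfolding direct_sum_rel_def by (metis direct_sum_uminus minus_diff_minus)

lift_definition times_\<A> :: "\<A> \<Rightarrow> \<A> \<Rightarrow> \<A>" is "(*)"
  unfolding direct_sum_rel_def
proof -
  fix x x' y y' :: prime_prod
  assume "x - x' \<in> direct_sum" "y - y' \<in> direct_sum"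
  then have "y * (x - x') + x' * (y - y') \<in> direct_sum"
    by (intro direct_sum_add direct_sum_mult)
  then show "x * y - x' * y' \<in> direct_sum" by (simp add: algebra_simps)
qed

instance
proof
  fix x y z :: \<A>
  show "x + y + z = x + (y + z)"
    by transfer (simp add: direct_sum_rel_def direct_sum_zero add.assoc)
  show "x + y = y + x"
    by transfer (simp add: direct_sum_rel_def direct_sum_zero add.commute)
  show "0 + x = x"
    by transfer (simp add: direct_sum_rel_def direct_sum_zero)
  show "- x + x = 0"
    by transfer (simp add: direct_sum_rel_def direct_sum_zero)
  show "x - y = x + - y"
    by transfer (simp add: direct_sum_rel_def direct_sum_zero)
  show "x * y * z = x * (y * z)"
    by transfer (simp add: direct_sum_rel_def direct_sum_zero mult.assoc)
  show "x * y = y * x"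
    by transfer (simp add: direct_sum_rel_def direct_sum_zero mult.commute)
  show "1 * x = x"
    by transfer (simp add: direct_sum_rel_def direct_sum_zero)
  show "(x + y) * z = x * z + y * z"
    by transfer (simp add: direct_sum_rel_def direct_sum_zero distrib_right)
  show "(0 :: \<A>) \<noteq> 1"
  proof transfer
    show "\<not> direct_sum_rel 0 1"
      using direct_sum_uminus[of "0 - 1"] one_notin_direct_sum
      by (auto simp: direct_sum_rel_def)
  qed
qed

end


section \<open>Finite multiple \<open>T\<close>-values\<close>

text \<open>
  Lists are indexed from \<open>0\<close>, so \<open>ms ! i\<close> is \<open>m\<^bsub>i+1\<^esub>\<close>, whose parity is that of \<open>i + 1\<close>.
\<close>

definition T_indices :: "nat \<Rightarrow> nat \<Rightarrow> nat list set" where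
  "T_indices p r = {ms. length ms = r \<and> sorted_wrt (<) ms \<and> set ms \<subseteq> {0<..<p} \<and>
     (\<forall>i<r. [ms ! i = i + 1] (mod 2))}"

text \<open>
  An integer representative of the component at \<open>p\<close>. All \<open>m\<^sub>i\<close> lie strictly between \<open>0\<close> and \<open>p\<close>,
  so for prime \<open>p\<close> the denominators are coprime to \<open>p\<close> and the modular inverse is a genuine one.
\<close>

definition T_component :: "nat list \<Rightarrow> nat \<Rightarrow> int" where
  "T_component ks p = 2 ^ length ks *
     (\<Sum>ms\<in>T_indices p (length ks).
        modular_inverse (int p) (\<Prod>i<length ks. int (ms ! i) ^ (ks ! i)))"

definition T_\<A> :: "nat list \<Rightarrow> \<A>" where
  "T_\<A> ks = to_\<A> (reduce (T_component ks))"

end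

theory Submission
  imports Defs "HOL-Computational_Algebra.Formal_Power_Series"
begin

text \<open>
  Modulo \<open>p\<close>, the finite \<open>T\<close>-values of even depth are coefficients at \<open>t\<^sup>p\<close> of \<open>Y F\<close>, where
  \<open>Y = t + t\<^sup>3 + t\<^sup>5 + \<dots>\<close> and \<open>F\<close> is an iterated integral built from the inverse \<open>D\<close> of
  \<open>\<theta> = t d/dt\<close> and from \<open>J f = D (Y f)\<close>. Write \<open>P\<^sub>i = J\<^sup>i 1\<close> and \<open>Q\<^sub>b\<^sub>,\<^sub>d = J\<^sup>b D P\<^sub>d\<close>. As \<open>\<theta>\<close> multiplies
  the coefficient at \<open>t\<^sup>p\<close> by \<open>p\<close>, integration by parts has no boundary term modulo \<open>p\<close>; it moves
  \<open>J\<close> from one factor to the other up to sign, and it yields the reversal symmetry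
  \<open>T\<^sub>n\<^sub>-\<^sub>j = - T\<^sub>j\<close> (\<open>n = a + 1\<close> odd). Integrating the shuffle-type identity
  \<open>\<Sum>\<^sub>i\<^sub>\<le>\<^sub>m (-1)\<^sup>m\<^sup>-\<^sup>i P\<^sub>i Q\<^sub>b\<^sub>,\<^sub>m\<^sub>-\<^sub>i\<^sub>+\<^sub>1 = \<Sum>\<^sub>i\<^sub>\<le>\<^sub>m (b+i choose b) Q\<^sub>b\<^sub>+\<^sub>i\<^sub>,\<^sub>m\<^sub>-\<^sub>i\<^sub>+\<^sub>1\<close> with \<open>b = n - m\<close> gives
  \<open>\<Sum>\<^sub>j\<^sub>\<le>\<^sub>m (n-j choose n-m) T\<^sub>j = (-1)\<^sup>m \<Sum>\<^sub>j\<^sub>\<le>\<^sub>m T\<^sub>j\<close>, which is equivalent to the claim because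
  \<open>\<Sum>\<^sub>j T\<^sub>j = 0\<close> by the reversal symmetry.
\<close>

unbundle fps_syntax

section \<open>Iterated integrals modulo a prime\<close>

definition odd_series :: "int fps" where
  "odd_series = Abs_fps (\<lambda>k. of_bool (odd k))"

lemma odd_series_nth_0 [simp]: "odd_series $ 0 = 0"
  by (simp add: odd_series_def)

text \<open>Only smaller indices of opposite parity enter, which is the condition linking
  consecutive indices in a \<open>T\<close>-value.\<close>

lemma odd_series_mult_nth:
  "(odd_series * f) $ k = (\<Sum>l | l < k \<and> odd (k - l). f $ l)"
proof -
  have "(odd_series * f) $ k = (\<Sum>l = 0..k. f $ l * of_bool (odd (k - l)))"
    by (subst mult.commute) (simp add: fps_mult_nth odd_series_def)
  also have "\<dots> = (\<Sum>l \<in> {0..k}. if odd (k - l) then f $ l else 0)"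
    by (intro sum.cong) auto
  also have "\<dots> = (\<Sum>l \<in> {l \<in> {0..k}. odd (k - l)}. f $ l)"
    by (simp only: sum.inter_filter finite_atLeastAtMost)
  also have "{l \<in> {0..k}. odd (k - l)} = {l. l < k \<and> odd (k - l)}"
    by (auto simp: le_less)
  finally show ?thesis .
qed

lemma fps_XD_mult: "fps_XD (f * g) = fps_XD f * g + f * fps_XD (g :: 'a :: comm_ring_1 fps)"
  by (simp add: fps_XD_def algebra_simps)

lemma fps_XD_sum: "fps_XD (sum f A) = (\<Sum>i\<in>A. fps_XD (f i :: 'a :: comm_ring_1 fps))"
  by (simp add: fps_XD_def fps_deriv_sum sum_distrib_left)

lemma fps_XD_of_nat_mult:
  "fps_XD (of_nat c * f) = of_nat c * fps_XD (f :: 'a :: comm_ring_1 fps)"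
  by (metis fps_XD_mult_const fps_of_nat)

lemma fps_XD_minus_one_power_mult:
  "fps_XD ((- 1) ^ n * f) = (- 1) ^ n * fps_XD (f :: 'a :: comm_ring_1 fps)"
  by (cases "even n") (simp_all add: fps_XD_def)

section \<open>Congruence of power series in degrees below a prime\<close>

locale prime_modulus =
  fixes p :: nat
  assumes prime_p: "prime p"
begin

lemma coprime_p: "0 < k \<Longrightarrow> k < p \<Longrightarrow> coprime (int k) (int p)"
  using prime_p by (metis coprime_commute coprime_int_iff nat_dvd_not_less prime_imp_coprime)

text \<open>Truncating below \<open>p\<close> is harmless: \<open>odd_series\<close> has no constant
  term, so the coefficient of \<open>odd_series * f\<close> at \<open>p\<close> involves only lower
  coefficients of \<open>f\<close>.\<close>

definition fps_cong :: "int fps \<Rightarrow> int fps \<Rightarrow> bool" (infix \<open>\<approx>\<close> 50) where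
  "f \<approx> g \<longleftrightarrow> (\<forall>k<p. [f $ k = g $ k] (mod int p))"

lemma fps_cong_refl [simp]: "f \<approx> f"
  by (simp add: fps_cong_def)

lemma fps_cong_sym: "f \<approx> g \<Longrightarrow> g \<approx> f"
  by (simp add: fps_cong_def cong_sym)

lemma fps_cong_trans [trans]: "f \<approx> g \<Longrightarrow> g \<approx> h \<Longrightarrow> f \<approx> h"
  unfolding fps_cong_def by (meson cong_trans)

text \<open>Without these, calculations fall back on higher-order substitution, which diverges on large sums.\<close>

lemma fps_cong_eq_trans [trans]:
  "f = g \<Longrightarrow> g \<approx> h \<Longrightarrow> f \<approx> h"
  "f \<approx> g \<Longrightarrow> g = h \<Longrightarrow> f \<approx> h"
  by simp_all

lemma fps_cong_add: "f \<approx> f' \<Longrightarrow> g \<approx> g' \<Longrightarrow> f + g \<approx> f' + g'"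
  by (simp add: fps_cong_def cong_add)

lemma fps_cong_mult: "f \<approx> f' \<Longrightarrow> g \<approx> g' \<Longrightarrow> f * g \<approx> f' * g'"
  by (auto simp: fps_cong_def fps_mult_nth intro!: cong_sum cong_mult)

lemma fps_cong_sum: "(\<And>i. i \<in> A \<Longrightarrow> f i \<approx> g i) \<Longrightarrow> sum f A \<approx> sum g A"
  by (simp add: fps_cong_def fps_sum_nth cong_sum)

lemma cong_mult_nth_p:
  assumes "f \<approx> f'" and "g $ 0 = 0"
  shows "[(f * g) $ p = (f' * g) $ p] (mod int p)"
  unfolding fps_mult_nth
proof (rule cong_sum)
  fix i assume "i \<in> {0..p}"
  then show "[f $ i * g $ (p - i) = f' $ i * g $ (p - i)] (mod int p)"
    using assms by (cases "i = p") (auto simp: fps_cong_def intro: cong_mult)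
qed

text \<open>Each degree 0 < k < \<open>p\<close> can be cancelled modulo \<open>p\<close>; the
  constant term, lost under theta, is supplied separately.\<close>

lemma fps_cong_of_XD_cong:
  assumes "fps_XD f \<approx> fps_XD g" and "f $ 0 = g $ 0"
  shows "f \<approx> g"
  unfolding fps_cong_def
proof (intro allI impI)
  fix k assume "k < p"
  show "[f $ k = g $ k] (mod int p)"
  proof (cases "k = 0")
    case False
    with \<open>k < p\<close> have "coprime (int k) (int p)"
      by (intro coprime_p) simp_all
    moreover have "[int k * f $ k = int k * g $ k] (mod int p)"
      using assms(1) \<open>k < p\<close> by (simp add: fps_cong_def)
    ultimately show ?thesis
      by (simp add: cong_mult_lcancel)
  qed (simp add: assms(2))
qed

text \<open>A true inverse of theta only in degrees 0 < k < \<open>p\<close>: no inverse exists at 0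
  or at \<open>p\<close>, hence the truncation in \<open>\<approx>\<close> and the conditions on
  constant terms.\<close>

definition D :: "int fps \<Rightarrow> int fps" where
  "D f = Abs_fps (\<lambda>k. modular_inverse (int p) (int k) * f $ k)"

lemma D_nth: "D f $ k = modular_inverse (int p) (int k) * f $ k"
  by (simp add: D_def)

lemma XD_D:
  assumes "f $ 0 = 0"
  shows "fps_XD (D f) \<approx> f"
  unfolding fps_cong_def
proof (intro allI impI)
  fix k assume "k < p"
  show "[fps_XD (D f) $ k = f $ k] (mod int p)"
  proof (cases "k = 0")
    case False
    with \<open>k < p\<close> have "coprime (int k) (int p)"
      by (intro coprime_p) simp_all
    then have "[int k * modular_inverse (int p) (int k) * f $ k = 1 * f $ k] (mod int p)"
      by (intro cong_mult cong_modular_inverse1) auto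
    then show ?thesis
      by (simp add: D_nth mult.assoc)
  qed (simp add: assms)
qed

text \<open>The product rule at degree \<open>p\<close>. The zero constant terms keep the degree
  \<open>p\<close> coefficients of the other factors out, so congruences below \<open>p\<close>
  suffice.\<close>

lemma by_parts:
  assumes F: "fps_XD F \<approx> F'" "F $ 0 = 0" and G: "fps_XD G \<approx> G'" "G $ 0 = 0"
  shows "[(F' * G) $ p = - (F * G') $ p] (mod int p)"
proof -
  have "[(F' * G) $ p + (G' * F) $ p = (fps_XD F * G) $ p + (fps_XD G * F) $ p] (mod int p)"
    by (intro cong_add cong_mult_nth_p F(2) G(2) fps_cong_sym[OF F(1)] fps_cong_sym[OF G(1)])
  also have "(fps_XD F * G) $ p + (fps_XD G * F) $ p = int p * (F * G) $ p"
    using arg_cong[OF fps_XD_mult[of F G], of "\<lambda>h. h $ p"] by (simp add: mult.commute)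
  also have "[\<dots> = 0] (mod int p)"
    by (simp add: cong_0_iff)
  finally show ?thesis
    by (simp add: cong_iff_dvd_diff mult.commute)
qed

section \<open>Iterated integrals and the coefficient functional\<close>

definition J :: "int fps \<Rightarrow> int fps" where
  "J f = D (odd_series * f)"

definition P :: "nat \<Rightarrow> int fps" where
  "P i = (J ^^ i) 1"

definition Q :: "nat \<Rightarrow> nat \<Rightarrow> int fps" where
  "Q b d = (J ^^ b) (D (P d))"

definition \<phi> :: "int fps \<Rightarrow> int" where
  "\<phi> f = (odd_series * f) $ p"

lemma D_nth_0 [simp]: "D f $ 0 = modular_inverse (int p) 0 * f $ 0"
  by (simp add: D_nth)

lemma J_nth_0 [simp]: "J f $ 0 = 0"
  by (simp add: J_def)

lemma P_0 [simp]: "P 0 = 1" and P_Suc: "P (Suc i) = J (P i)"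
  by (simp_all add: P_def)

lemma Q_0: "Q 0 d = D (P d)" and Q_Suc: "Q (Suc b) d = J (Q b d)"
  by (simp_all add: Q_def)

lemma P_nth_0: "i > 0 \<Longrightarrow> P i $ 0 = 0"
  by (cases i) (simp_all add: P_Suc)

lemma Q_nth_0: "d > 0 \<Longrightarrow> Q b d $ 0 = 0"
  by (cases b) (simp_all add: Q_0 Q_Suc P_nth_0)

lemma XD_J: "fps_XD (J f) \<approx> odd_series * f"
  unfolding J_def by (rule XD_D) simp

lemma XD_P_Suc: "fps_XD (P (Suc i)) \<approx> odd_series * P i"
  by (simp add: P_Suc XD_J)

lemma XD_Q_Suc: "fps_XD (Q (Suc b) d) \<approx> odd_series * Q b d"
  by (simp add: Q_Suc XD_J)

lemma XD_Q_0: "d > 0 \<Longrightarrow> fps_XD (Q 0 d) \<approx> P d"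
  by (simp add: Q_0 XD_D P_nth_0)

lemma fps_XD_one [simp]: "fps_XD (1 :: int fps) = 0"
  by (simp add: fps_XD_def)

section \<open>Integration by parts under \<open>\<phi>\<close>\<close>

lemma \<phi>_cong: "f \<approx> g \<Longrightarrow> [\<phi> f = \<phi> g] (mod int p)"
  unfolding \<phi>_def by (subst (1 2) mult.commute) (rule cong_mult_nth_p, auto)

lemma \<phi>_sum: "\<phi> (sum f A) = (\<Sum>i\<in>A. \<phi> (f i))"
  by (simp add: \<phi>_def sum_distrib_left fps_sum_nth)

lemma \<phi>_const_mult: "\<phi> (fps_const c * f) = c * \<phi> f"
  by (simp add: \<phi>_def mult.left_commute[of odd_series])

text \<open>Skew-adjointness of \<open>J\<close> for the pairing \<open>\<phi> (f * g)\<close>: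
  integrate \<open>J g\<close> and \<open>J f\<close> by parts.\<close>

lemma \<phi>_J_mult: "[\<phi> (J f * g) = - \<phi> (f * J g)] (mod int p)"
  using by_parts[OF XD_J J_nth_0 XD_J J_nth_0, of g f]
  by (simp add: \<phi>_def mult_ac)

text \<open>The \<open>i\<close> copies of \<open>J\<close> in \<open>P i\<close> move onto
  \<open>f\<close> one at a time, each costing a sign.\<close>

lemma \<phi>_P_mult: "[\<phi> (P i * f) = (- 1) ^ i * \<phi> ((J ^^ i) f)] (mod int p)"
proof (induction i arbitrary: f)
  case (Suc i)
  have "[\<phi> (P (Suc i) * f) = - \<phi> (P i * J f)] (mod int p)"
    unfolding P_Suc by (rule \<phi>_J_mult)
  also have "[- \<phi> (P i * J f) = - ((- 1) ^ i * \<phi> ((J ^^ i) (J f)))] (mod int p)"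
    using Suc.IH cong_minus_minus_iff by blast
  finally show ?case
    by (simp add: funpow_swap1)
qed simp

lemma \<phi>_P_mult_Q: "[\<phi> (P i * Q b d) = (- 1) ^ i * \<phi> (Q (i + b) d)] (mod int p)"
  using \<phi>_P_mult[of i "Q b d"] by (simp add: Q_def funpow_add)

text \<open>Both sides reduce to minus the coefficient of \<open>P (Suc b) * P (Suc d)\<close> at
  \<open>p\<close>, which is symmetric in \<open>b\<close> and \<open>d\<close>.\<close>

lemma \<phi>_reversal:
  "[(- 1) ^ b * \<phi> (Q b (Suc d)) = (- 1) ^ d * \<phi> (Q d (Suc b))] (mod int p)"
proof -
  have "[(odd_series * P b * Q 0 (Suc d)) $ p = - (P (Suc b) * P (Suc d)) $ p] (mod int p)" for b d
    by (rule by_parts) (simp_all add: XD_P_Suc XD_Q_0 P_nth_0 Q_nth_0)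
  then have *: "[\<phi> (P b * Q 0 (Suc d)) = - (P (Suc b) * P (Suc d)) $ p] (mod int p)" for b d
    by (simp add: \<phi>_def mult.assoc)
  have "[\<phi> (P b * Q 0 (Suc d)) = \<phi> (P d * Q 0 (Suc b))] (mod int p)"
    using *[of b d] *[of d b] by (metis cong_sym cong_trans mult.commute)
  then show ?thesis
    using \<phi>_P_mult_Q[of b 0 "Suc d"] \<phi>_P_mult_Q[of d 0 "Suc b"]
    by (metis add_0_right cong_sym cong_trans)
qed

section \<open>Signed convolutions of iterated integrals\<close>

text \<open>This is \<open>exp (- x) exp x = 1\<close> for the divided powers \<open>P\<^sub>i = x\<^sup>i / i!\<close> of \<open>x = P\<^sub>1\<close>.\<close>

lemma P_alternating_sum:
  assumes "n > 0"
  shows "(\<Sum>i\<le>n. (- 1) ^ (n - i) * (P i * P (n - i))) \<approx> 0"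
proof (rule fps_cong_of_XD_cong)
  obtain k where n: "n = Suc k"
    using assms gr0_implies_Suc by blast
  have "fps_XD (\<Sum>i\<le>n. (- 1) ^ (n - i) * (P i * P (n - i))) =
      (\<Sum>i\<le>n. (- 1) ^ (n - i) * (fps_XD (P i) * P (n - i))) +
      (\<Sum>i\<le>n. (- 1) ^ (n - i) * (P i * fps_XD (P (n - i))))"
    by (simp only: fps_XD_sum fps_XD_minus_one_power_mult)
      (simp add: fps_XD_mult sum.distrib distrib_left)
  \<comment> \<open>The term i = 0 drops out because theta kills \<open>P 0 = 1\<close>.\<close>
  also have "(\<Sum>i\<le>n. (- 1) ^ (n - i) * (fps_XD (P i) * P (n - i))) =
      (\<Sum>i\<le>k. (- 1) ^ (k - i) * (fps_XD (P (Suc i)) * P (k - i)))"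
    unfolding n by (subst sum.atMost_Suc_shift) simp
  also have "(\<Sum>i\<le>n. (- 1) ^ (n - i) * (P i * fps_XD (P (n - i)))) =
      (\<Sum>i\<le>k. - ((- 1) ^ (k - i)) * (P i * fps_XD (P (Suc (k - i)))))"
    unfolding n by (simp add: Suc_diff_le)
  also have "(\<Sum>i\<le>k. (- 1) ^ (k - i) * (fps_XD (P (Suc i)) * P (k - i))) +
      (\<Sum>i\<le>k. - ((- 1) ^ (k - i)) * (P i * fps_XD (P (Suc (k - i))))) \<approx>
      (\<Sum>i\<le>k. (- 1) ^ (k - i) * ((odd_series * P i) * P (k - i))) +
      (\<Sum>i\<le>k. - ((- 1) ^ (k - i)) * (P i * (odd_series * P (k - i))))"
    by (intro fps_cong_add fps_cong_sum fps_cong_mult XD_P_Suc fps_cong_refl)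
  \<comment> \<open>The two sums now agree up to sign and cancel term by term.\<close>
  also have "\<dots> = fps_XD 0"
    unfolding sum.distrib[symmetric]
    by (simp add: mult.left_commute mult.assoc fps_XD_def)
  finally show "fps_XD (\<Sum>i\<le>n. (- 1) ^ (n - i) * (P i * P (n - i))) \<approx> fps_XD 0" .
next
  have "P i $ 0 * P (n - i) $ 0 = 0" if "i \<le> n" for i
    using that assms by (cases "i = 0") (auto simp: P_nth_0)
  then have "((- 1) ^ (n - i) * (P i * P (n - i))) $ 0 = 0" if "i \<le> n" for i
    using that by simp
  then show "(\<Sum>i\<le>n. (- 1) ^ (n - i) * (P i * P (n - i))) $ 0 = (0 :: int fps) $ 0"
    by (simp add: fps_sum_nth del: fps_mult_nth_0)
qed

text \<open>Split the term i = \<open>Suc m\<close> off the vanishing full sum; the remaining signs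
  all flip.\<close>

lemma P_Suc_alternating_sum:
  "(\<Sum>i\<le>m. (- 1) ^ (m - i) * (P i * P (Suc m - i))) \<approx> P (Suc m)"
proof -
  have "P (Suc m) + (-1) * (\<Sum>i\<le>Suc m. (- 1) ^ (Suc m - i) * (P i * P (Suc m - i))) \<approx>
      P (Suc m) + (-1) * 0"
    by (intro fps_cong_add fps_cong_mult fps_cong_refl P_alternating_sum) simp
  moreover have "P (Suc m) + (-1) * (\<Sum>i\<le>Suc m. (- 1) ^ (Suc m - i) * (P i * P (Suc m - i))) =
      (\<Sum>i\<le>m. (- 1) ^ (m - i) * (P i * P (Suc m - i)))"
    by (simp add: Suc_diff_le sum_negf)
  ultimately show ?thesis
    by simp
qed

text \<open>Theta turns either side at (m, b) into \<open>odd_series\<close> times the sum of its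
  values at (m-1, b) and (m, b-1); on the right this is Pascal's rule. For b = 0 the second
  contribution is \<open>P (Suc m)\<close> instead.\<close>

lemma P_Q_alternating_sum:
  "(\<Sum>i\<le>m. (- 1) ^ (m - i) * (P i * Q b (Suc (m - i)))) \<approx>
   (\<Sum>i\<le>m. of_nat ((b + i) choose b) * Q (b + i) (Suc (m - i)))"
  (is "?V m b \<approx> ?W m b")
proof (induction "m + b" arbitrary: m b rule: less_induct)
  case less
  show ?case
  proof (cases m)
    case 0
    then show ?thesis by simp
  next
    case m: (Suc k)
    have XD_V: "fps_XD (?V m b) \<approx> odd_series * ?V k b +
        (\<Sum>i\<le>m. (- 1) ^ (m - i) * (P i * fps_XD (Q b (Suc (m - i)))))"
    proof -
      have "fps_XD (?V m b) =
          (\<Sum>i\<le>m. (- 1) ^ (m - i) * (fps_XD (P i) * Q b (Suc (m - i)))) +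
          (\<Sum>i\<le>m. (- 1) ^ (m - i) * (P i * fps_XD (Q b (Suc (m - i)))))"
        by (simp only: fps_XD_sum fps_XD_minus_one_power_mult)
      (simp add: fps_XD_mult sum.distrib distrib_left)
      also have "(\<Sum>i\<le>m. (- 1) ^ (m - i) * (fps_XD (P i) * Q b (Suc (m - i)))) =
          (\<Sum>i\<le>k. (- 1) ^ (k - i) * (fps_XD (P (Suc i)) * Q b (Suc (k - i))))"
        unfolding m by (subst sum.atMost_Suc_shift) simp
      also have "\<dots> + (\<Sum>i\<le>m. (- 1) ^ (m - i) * (P i * fps_XD (Q b (Suc (m - i))))) \<approx>
          (\<Sum>i\<le>k. (- 1) ^ (k - i) * ((odd_series * P i) * Q b (Suc (k - i)))) +
          (\<Sum>i\<le>m. (- 1) ^ (m - i) * (P i * fps_XD (Q b (Suc (m - i)))))"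
        by (intro fps_cong_add fps_cong_sum fps_cong_mult XD_P_Suc fps_cong_refl)
      also have "\<dots> = odd_series * ?V k b +
          (\<Sum>i\<le>m. (- 1) ^ (m - i) * (P i * fps_XD (Q b (Suc (m - i)))))"
        by (simp add: sum_distrib_left mult.left_commute mult.assoc)
      finally show ?thesis .
    qed
    have XD_W: "fps_XD (?W m b) =
        (\<Sum>i\<le>m. of_nat ((b + i) choose b) * fps_XD (Q (b + i) (Suc (m - i))))"
      by (simp add: fps_XD_sum fps_XD_of_nat_mult)
    show ?thesis
    proof (rule fps_cong_of_XD_cong)
      show "fps_XD (?V m b) \<approx> fps_XD (?W m b)"
      proof (cases b)
        case 0
        have "fps_XD (?V m b) \<approx> odd_series * ?V k b +
            (\<Sum>i\<le>m. (- 1) ^ (m - i) * (P i * fps_XD (Q b (Suc (m - i)))))"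
          by (rule XD_V)
        also have "\<dots> \<approx> odd_series * ?W k b +
            (\<Sum>i\<le>m. (- 1) ^ (m - i) * (P i * P (Suc (m - i))))"
          unfolding 0
          by (intro fps_cong_add fps_cong_sum fps_cong_mult fps_cong_refl XD_Q_0 less) (auto simp: 0 m)
        also have "\<dots> = odd_series * ?W k b +
            (\<Sum>i\<le>m. (- 1) ^ (m - i) * (P i * P (Suc m - i)))"
          by (simp add: Suc_diff_le)
        also have "\<dots> \<approx> odd_series * ?W k b + P (Suc m)"
          by (intro fps_cong_add fps_cong_refl P_Suc_alternating_sum)
        also have "\<dots> = P (Suc m) + (\<Sum>i\<le>k. odd_series * Q i (Suc (k - i)))"
          by (simp add: 0 sum_distrib_left add.commute)
        also have "\<dots> \<approx> fps_XD (Q 0 (Suc m)) + (\<Sum>i\<le>k. fps_XD (Q (Suc i) (Suc (k - i))))"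
          by (intro fps_cong_add fps_cong_sum fps_cong_sym[OF XD_Q_Suc] fps_cong_sym[OF XD_Q_0]) simp
        also have "\<dots> = fps_XD (?W m b)"
          unfolding XD_W unfolding m by (subst sum.atMost_Suc_shift) (simp add: 0)
        finally show ?thesis .
      next
        case b: (Suc c)
        have "fps_XD (?V m b) \<approx> odd_series * ?V k b +
            (\<Sum>i\<le>m. (- 1) ^ (m - i) * (P i * fps_XD (Q b (Suc (m - i)))))"
          by (rule XD_V)
        also have "\<dots> \<approx> odd_series * ?V k b +
            (\<Sum>i\<le>m. (- 1) ^ (m - i) * (P i * (odd_series * Q c (Suc (m - i)))))"
          unfolding b by (intro fps_cong_add fps_cong_sum fps_cong_mult fps_cong_refl XD_Q_Suc)
        also have "\<dots> = odd_series * ?V k b + odd_series * ?V m c"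
          by (simp add: sum_distrib_left mult.left_commute mult.assoc)
        also have "\<dots> \<approx> odd_series * ?W k b + odd_series * ?W m c"
          by (intro fps_cong_add fps_cong_mult fps_cong_refl less) (auto simp: b m)
        also have "odd_series * ?W k b + odd_series * ?W m c =
            (\<Sum>i\<le>m. of_nat ((b + i) choose b) * (odd_series * Q (c + i) (Suc (m - i))))"
        proof -
          \<comment> \<open>The added term i = 0 has coefficient \<open>c choose Suc c\<close>,
            which is 0; both sums then share a range and Pascal's rule applies.\<close>
          have "odd_series * ?W k b =
              (\<Sum>i\<le>m. of_nat ((c + i) choose b) * (odd_series * Q (c + i) (Suc (m - i))))"
            unfolding m by (subst sum.atMost_Suc_shift) (simp add: b sum_distrib_left mult_ac)
          then show ?thesis
            by (simp only: sum_distrib_left sum.distrib[symmetric]) (simp add: b algebra_simps)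
        qed
        also have "\<dots> \<approx> (\<Sum>i\<le>m. of_nat ((b + i) choose b) * fps_XD (Q (b + i) (Suc (m - i))))"
          unfolding b add_Suc by (intro fps_cong_sum fps_cong_mult fps_cong_sym[OF XD_Q_Suc]) simp
        finally show ?thesis
          unfolding XD_W .
      qed
      show "?V m b $ 0 = ?W m b $ 0"
        by (simp add: fps_sum_nth Q_nth_0)
    qed
  qed
qed

text \<open>Apply \<open>\<phi>\<close> to the convolution identity with b = n - m. Moving
  \<open>P i\<close> across gives the sign (-1)^i, which combines with (-1)^(m-i) to the constant
  (-1)^m.\<close>

lemma \<phi>_Q_relation:
  assumes "m \<le> n"
  shows "[(\<Sum>j\<le>m. int ((n - j) choose (n - m)) * \<phi> (Q (n - j) (Suc j))) =
          (- 1) ^ m * (\<Sum>j\<le>m. \<phi> (Q (n - j) (Suc j)))] (mod int p)"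
proof -
  let ?b = "n - m"
  have sgn: "\<phi> ((- 1) ^ k * f) = (- 1) ^ k * \<phi> f" for k f
    using \<phi>_const_mult[of "(- 1) ^ k" f]
    by (simp add: fps_const_power[symmetric] fps_const_neg[symmetric] del: fps_const_power fps_const_neg)
  have nat: "\<phi> (of_nat k * f) = int k * \<phi> f" for k f
    using \<phi>_const_mult[of "int k" f] by (simp add: fps_of_nat)
  have "[\<phi> (\<Sum>i\<le>m. (- 1) ^ (m - i) * (P i * Q ?b (Suc (m - i)))) =
      \<phi> (\<Sum>i\<le>m. of_nat ((?b + i) choose ?b) * Q (?b + i) (Suc (m - i)))] (mod int p)"
    by (intro \<phi>_cong P_Q_alternating_sum)
  then have "[(\<Sum>i\<le>m. int ((?b + i) choose ?b) * \<phi> (Q (?b + i) (Suc (m - i)))) =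
      (\<Sum>i\<le>m. (- 1) ^ (m - i) * \<phi> (P i * Q ?b (Suc (m - i))))] (mod int p)"
    by (simp only: \<phi>_sum sgn nat cong_sym_eq)
  also have "[(\<Sum>i\<le>m. (- 1) ^ (m - i) * \<phi> (P i * Q ?b (Suc (m - i)))) =
      (\<Sum>i\<le>m. (- 1) ^ (m - i) * ((- 1) ^ i * \<phi> (Q (i + ?b) (Suc (m - i)))))] (mod int p)"
    by (intro cong_sum cong_mult cong_refl \<phi>_P_mult_Q)
  also have "(\<Sum>i\<le>m. (- 1) ^ (m - i) * ((- 1) ^ i * \<phi> (Q (i + ?b) (Suc (m - i))))) =
      (- 1) ^ m * (\<Sum>i\<le>m. \<phi> (Q (?b + i) (Suc (m - i))))"
    by (simp add: sum_distrib_left mult.assoc[symmetric] power_add[symmetric] add.commute)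
  finally have *: "[(\<Sum>i\<le>m. int ((?b + i) choose ?b) * \<phi> (Q (?b + i) (Suc (m - i)))) =
      (- 1) ^ m * (\<Sum>i\<le>m. \<phi> (Q (?b + i) (Suc (m - i))))] (mod int p)" .
  have "(\<Sum>i\<le>m. f (?b + i) (m - i)) = (\<Sum>j\<le>m. f (n - j) j)" for f :: "nat \<Rightarrow> nat \<Rightarrow> int"
    by (rule sum.reindex_bij_witness[of _ "\<lambda>j. m - j" "\<lambda>i. m - i"]) (use assms in auto)
  from this[of "\<lambda>x y. int (x choose ?b) * \<phi> (Q x (Suc y))"] this[of "\<lambda>x y. \<phi> (Q x (Suc y))"] *
  show ?thesis
    by simp
qed

lemma corollary_mod_p:
  assumes "odd p" and "even a" and "m \<le> a"
  shows "[(\<Sum>j\<le>a + 1. (int ((a + 2) choose (m + 1)) - int ((a + 1 - j) choose (a - m + 1))) *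
             \<phi> (Q (a + 1 - j) (Suc j))) =
          (- 1) ^ (m + 1) * (\<Sum>j\<le>a - m. \<phi> (Q (a + 1 - j) (Suc j)))] (mod int p)"
proof -
  define n where "n = a + 1"
  define x where "x j = \<phi> (Q (n - j) (Suc j))" for j
  have reversal: "[x (n - j) = - x j] (mod int p)" if "j \<le> n" for j
  proof -
    \<comment> \<open>As \<open>n\<close> is odd, \<open>j\<close> and \<open>n - j\<close> have
      opposite parity, so the two signs in \<open>\<phi>_reversal\<close> are opposite.\<close>
    have "odd (n - j) \<longleftrightarrow> even j"
      using that \<open>even a\<close> by (auto simp: n_def)
    then have "int p dvd x j + x (n - j) \<or> int p dvd - (x j + x (n - j))"
      using \<phi>_reversal[of j "n - j"] that
      by (cases "even j") (simp_all add: x_def cong_iff_dvd_diff algebra_simps)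
    then show ?thesis
      by (auto simp: cong_iff_dvd_diff add.commute simp del: minus_add_distrib)
  qed
  \<comment> \<open>The reflection j -> n - j maps the indices above \<open>m\<close> onto 0..a-m,
    since n - m - 1 = a - m.\<close>
  have tail: "[(\<Sum>j\<le>a - m. x j) = - (\<Sum>j\<in>{m<..n}. x j)] (mod int p)"
  proof -
    have "(\<Sum>j\<le>a - m. x j) = (\<Sum>j\<in>{m<..n}. x (n - j))"
      by (rule sum.reindex_bij_witness[of _ "\<lambda>j. n - j" "\<lambda>j. n - j"]) (use assms in \<open>auto simp: n_def\<close>)
    also have "[\<dots> = (\<Sum>j\<in>{m<..n}. - x j)] (mod int p)"
      by (intro cong_sum reversal) auto
    finally show ?thesis
      by (simp add: sum_negf)
  qed
  have total: "[(\<Sum>j\<le>n. x j) = 0] (mod int p)"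
  proof -
    have "(\<Sum>j\<le>n. x j) = (\<Sum>j\<le>n. x (n - j))"
      by (rule sum.reindex_bij_witness[of _ "\<lambda>j. n - j" "\<lambda>j. n - j"]) auto
    also have "[\<dots> = (\<Sum>j\<le>n. - x j)] (mod int p)"
      by (intro cong_sum reversal) auto
    \<comment> \<open>The total equals its own negative; 2 is cancelled because \<open>p\<close> is
      odd.\<close>
    finally have "int p dvd 2 * (\<Sum>j\<le>n. x j)"
      by (simp add: cong_iff_dvd_diff sum_negf)
    then show ?thesis
      using \<open>odd p\<close> by (simp add: coprime_dvd_mult_right_iff cong_0_iff)
  qed
  have "{..n} = {..m} \<union> {m<..n}"
    using assms by (auto simp: n_def)
  then have split: "(\<Sum>j\<le>n. f j) = (\<Sum>j\<le>m. f j) + (\<Sum>j\<in>{m<..n}. f j)" for f :: "nat \<Rightarrow> int"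
    by (metis finite_atMost finite_greaterThanAtMost ivl_disj_int_one(3) sum.union_disjoint)
  have "[(\<Sum>j\<le>a - m. x j) = - (\<Sum>j\<in>{m<..n}. x j) + 0] (mod int p)"
    using tail by simp
  also have "[- (\<Sum>j\<in>{m<..n}. x j) + 0 = - (\<Sum>j\<in>{m<..n}. x j) + (\<Sum>j\<le>n. x j)] (mod int p)"
    by (intro cong_add cong_refl cong_sym[OF total])
  finally have head: "[(\<Sum>j\<le>a - m. x j) = (\<Sum>j\<le>m. x j)] (mod int p)"
    by (simp add: split)
  \<comment> \<open>For j > m the lower entry \<open>n - m\<close> exceeds \<open>n - j\<close>, so
    the binomial is 0.\<close>
  have "(\<Sum>j\<in>{m<..n}. int ((n - j) choose (n - m)) * x j) = 0"
    using assms by (intro sum.neutral) (auto simp: n_def binomial_eq_0)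
  then have "(\<Sum>j\<le>n. int ((n - j) choose (n - m)) * x j) =
      (\<Sum>j\<le>m. int ((n - j) choose (n - m)) * x j)"
    by (simp add: split)
  then have "(\<Sum>j\<le>n. (int ((a + 2) choose (m + 1)) - int ((n - j) choose (n - m))) * x j) =
      int ((a + 2) choose (m + 1)) * (\<Sum>j\<le>n. x j) -
      (\<Sum>j\<le>m. int ((n - j) choose (n - m)) * x j)"
    by (simp add: left_diff_distrib sum_subtractf sum_distrib_left)
  also have "[\<dots> = int ((a + 2) choose (m + 1)) * 0 - (- 1) ^ m * (\<Sum>j\<le>m. x j)] (mod int p)"
    using assms unfolding x_def
    by (intro cong_diff cong_mult cong_refl total[unfolded x_def] \<phi>_Q_relation) (simp add: n_def)
  also have "int ((a + 2) choose (m + 1)) * 0 - (- 1) ^ m * (\<Sum>j\<le>m. x j) =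
      (- 1) ^ (m + 1) * (\<Sum>j\<le>m. x j)"
    by simp
  also have "[\<dots> = (- 1) ^ (m + 1) * (\<Sum>j\<le>a - m. x j)] (mod int p)"
    by (intro cong_mult cong_refl cong_sym[OF head])
  finally show ?thesis
    using \<open>m \<le> a\<close> by (simp add: x_def n_def Suc_diff_le)
qed

end


section \<open>Finite multiple \<open>T\<close>-values as coefficients\<close>

lemma cong_2_iff_parity: "[i = k] (mod 2) \<longleftrightarrow> (even i \<longleftrightarrow> even k)" for i k :: nat
  by (simp add: cong_def mod2_eq_if)

lemma T_indices_0 [simp]: "T_indices q 0 = {[]}"
  by (auto simp: T_indices_def)

lemma finite_T_indices: "finite (T_indices q r)"
  by (rule finite_subset[OF _ finite_lists_length_eq[of "{0<..<q}" r]]) (auto simp: T_indices_def)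

lemma append_in_T_indices_iff:
  "ms @ [m] \<in> T_indices q (Suc r) \<longleftrightarrow>
    m < q \<and> 0 < m \<and> [m = r + 1] (mod 2) \<and> ms \<in> T_indices m r"
proof (cases "length ms = r")
  case True
  then have "(\<forall>i<Suc r. [(ms @ [m]) ! i = i + 1] (mod 2)) \<longleftrightarrow>
      [m = r + 1] (mod 2) \<and> (\<forall>i<r. [ms ! i = i + 1] (mod 2))"
    by (simp add: All_less_Suc nth_append)
  then show ?thesis
    using True by (auto simp: T_indices_def sorted_wrt_append)
qed (simp add: T_indices_def)

text \<open>Splitting off the largest index \<open>m\<close> makes it the strict bound for the rest,
  matching the recursion for coefficients of iterated integrals.\<close>

lemma T_indices_Suc:
  "T_indices q (Suc r) =
    (\<Union>m\<in>{m. m < q \<and> 0 < m \<and> [m = r + 1] (mod 2)}. (\<lambda>ms. ms @ [m]) ` T_indices m r)"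
proof (intro equalityI subsetI)
  fix ms assume ms: "ms \<in> T_indices q (Suc r)"
  then obtain ms' m where "ms = ms' @ [m]"
    by (auto simp: T_indices_def length_Suc_conv_rev)
  with ms show "ms \<in> (\<Union>m\<in>{m. m < q \<and> 0 < m \<and> [m = r + 1] (mod 2)}.
      (\<lambda>ms. ms @ [m]) ` T_indices m r)"
    by (simp only: append_in_T_indices_iff) blast
qed (auto simp: append_in_T_indices_iff)

context prime_modulus
begin

text \<open>Folding from the left makes the last entry, attached to the largest index, the outermost
  integration.\<close>

definition iterated :: "nat list \<Rightarrow> int fps" where
  "iterated ks = foldl (\<lambda>f k. (D ^^ k) (odd_series * f)) 1 ks"

lemma D_funpow_nth: "(D ^^ k) f $ i = modular_inverse (int p) (int i) ^ k * f $ i"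
  by (induction k) (simp_all add: D_nth mult.assoc)

text \<open>Each entry 1 applies \<open>J\<close>; the entry 2 applies \<open>D\<close> after
  \<open>J\<close>, and this extra \<open>J\<close> raises \<open>P j\<close> to
  \<open>P (Suc j)\<close>.\<close>

lemma iterated_hook: "iterated (replicate j 1 @ [2] @ replicate b 1) = Q b (Suc j)"
proof -
  have foldl_ones: "foldl (\<lambda>f k. (D ^^ k) (odd_series * f)) f (replicate i 1) = (J ^^ i) f" for f i
    by (induction i arbitrary: f) (simp_all add: J_def funpow_swap1)
  show ?thesis
    unfolding iterated_def foldl_append foldl_ones
    by (simp add: Q_def P_def J_def numeral_2_eq_2)
qed

text \<open>Induction on the last entry. The bound \<open>q\<close> stays arbitrary because the
  largest index becomes the bound for the remaining ones.\<close>

lemma sum_T_indices: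
  assumes "q > 0"
  shows "(\<Sum>ms\<in>T_indices q (length ks).
            \<Prod>i<length ks. modular_inverse (int p) (int (ms ! i)) ^ (ks ! i)) =
         (\<Sum>l | l < q \<and> [l = length ks] (mod 2). iterated ks $ l)"
  using assms
proof (induction ks arbitrary: q rule: rev_induct)
  case Nil
  have "(\<Sum>l | l < q \<and> [l = 0] (mod 2). (1 :: int fps) $ l) = (\<Sum>l\<in>{0}. (1 :: int fps) $ l)"
    by (rule sum.mono_neutral_right) (use Nil in \<open>auto simp: fps_one_nth\<close>)
  then show ?case
    by (simp add: iterated_def)
next
  case (snoc k ks)
  define r where "r = length ks"
  define w where "w i = modular_inverse (int p) (int i)" for i :: nat
  define M where "M = {m. m < q \<and> 0 < m \<and> [m = r + 1] (mod 2)}"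
  have "(\<Sum>ms\<in>T_indices q (Suc r). \<Prod>i<Suc r. w (ms ! i) ^ ((ks @ [k]) ! i)) =
      (\<Sum>m\<in>M. \<Sum>ms\<in>(\<lambda>ms. ms @ [m]) ` T_indices m r. \<Prod>i<Suc r. w (ms ! i) ^ ((ks @ [k]) ! i))"
    unfolding T_indices_Suc M_def by (intro sum.UNION_disjoint) (auto simp: finite_T_indices)
  also have "\<dots> = (\<Sum>m\<in>M. w m ^ k * (\<Sum>ms\<in>T_indices m r. \<Prod>i<r. w (ms ! i) ^ (ks ! i)))"
  proof (rule sum.cong[OF refl])
    fix m
    have "(\<Sum>ms\<in>(\<lambda>ms. ms @ [m]) ` T_indices m r. \<Prod>i<Suc r. w (ms ! i) ^ ((ks @ [k]) ! i)) =
        (\<Sum>ms\<in>T_indices m r. \<Prod>i<Suc r. w ((ms @ [m]) ! i) ^ ((ks @ [k]) ! i))"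
      by (subst sum.reindex) (auto simp: inj_on_def)
    also have "\<dots> = (\<Sum>ms\<in>T_indices m r. w m ^ k * (\<Prod>i<r. w (ms ! i) ^ (ks ! i)))"
      by (intro sum.cong refl) (auto simp: T_indices_def nth_append r_def mult.commute)
    finally show "(\<Sum>ms\<in>(\<lambda>ms. ms @ [m]) ` T_indices m r.
        \<Prod>i<Suc r. w (ms ! i) ^ ((ks @ [k]) ! i)) =
        w m ^ k * (\<Sum>ms\<in>T_indices m r. \<Prod>i<r. w (ms ! i) ^ (ks ! i))"
      by (simp add: sum_distrib_left)
  qed
  also have "\<dots> = (\<Sum>m\<in>M. iterated (ks @ [k]) $ m)"
  proof (rule sum.cong[OF refl])
    fix m assume m: "m \<in> M"
    have "l < m \<and> [l = r] (mod 2) \<longleftrightarrow> l < m \<and> odd (m - l)" for l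
      using m by (auto simp: M_def cong_2_iff_parity)
    then show "w m ^ k * (\<Sum>ms\<in>T_indices m r. \<Prod>i<r. w (ms ! i) ^ (ks ! i)) =
        iterated (ks @ [k]) $ m"
      using snoc.IH[of m] m
      by (simp add: M_def r_def w_def iterated_def D_funpow_nth odd_series_mult_nth)
  qed
  also have "\<dots> = (\<Sum>l | l < q \<and> [l = Suc r] (mod 2). iterated (ks @ [k]) $ l)"
    by (rule sum.mono_neutral_left) (auto simp: M_def iterated_def D_funpow_nth intro!: gr0I)
  finally show ?case
    by (simp add: r_def w_def)
qed

lemma T_component_cong:
  assumes "odd p" and "even (length ks)"
  shows "[T_component ks p = 2 ^ length ks * \<phi> (iterated ks)] (mod int p)"
proof -
  have inverse_prod: "[modular_inverse (int p) (\<Prod>i<length ks. int (ms ! i) ^ (ks ! i)) =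
      (\<Prod>i<length ks. modular_inverse (int p) (int (ms ! i)) ^ (ks ! i))] (mod int p)"
    if "ms \<in> T_indices p (length ks)" for ms
  proof -
    let ?x = "\<Prod>i<length ks. int (ms ! i) ^ (ks ! i)"
    let ?y = "\<Prod>i<length ks. modular_inverse (int p) (int (ms ! i)) ^ (ks ! i)"
    have cop: "coprime (int (ms ! i)) (int p)" if "i < length ks" for i
    proof -
      have "ms ! i \<in> {0<..<p}"
        using that \<open>ms \<in> _\<close> by (auto simp: T_indices_def subset_iff)
      then show ?thesis
        by (intro coprime_p) simp_all
    qed
    have "?x * ?y = (\<Prod>i<length ks. (int (ms ! i) * modular_inverse (int p) (int (ms ! i))) ^ (ks ! i))"
      by (simp add: prod.distrib power_mult_distrib)
    also have "[\<dots> = (\<Prod>i<length ks. 1 ^ (ks ! i))] (mod int p)"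
      by (intro cong_prod cong_pow cong_modular_inverse1 cop) auto
    finally have xy: "[?x * ?y = 1] (mod int p)"
      by simp
    have "coprime ?x (int p)"
      by (intro prod_coprime_left coprime_power_left_iff[THEN iffD2] disjI1) (use cop in simp)
    then have "[?x * modular_inverse (int p) ?x = ?x * ?y] (mod int p)"
      using xy by (meson cong_modular_inverse1 cong_sym cong_trans)
    then show ?thesis
      using \<open>coprime ?x (int p)\<close> by (simp add: cong_mult_lcancel)
  qed
  have "l < p \<and> [l = length ks] (mod 2) \<longleftrightarrow> l < p \<and> odd (p - l)" for l
    using assms by (auto simp: cong_2_iff_parity)
  then have "\<phi> (iterated ks) = (\<Sum>ms\<in>T_indices p (length ks).
      \<Prod>i<length ks. modular_inverse (int p) (int (ms ! i)) ^ (ks ! i))"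
    using prime_p by (simp add: \<phi>_def odd_series_mult_nth sum_T_indices prime_gt_0_nat)
  then show ?thesis
    unfolding T_component_def by (simp add: cong_mult cong_sum inverse_prod)
qed

end


section \<open>Relations in \<open>\<A>\<close>\<close>

lemma to_\<A>_reduce_cong:
  assumes "\<And>p. prime p \<Longrightarrow> odd p \<Longrightarrow> [f p = g p] (mod int p)"
  shows "to_\<A> (reduce f) = to_\<A> (reduce g)"
proof -
  have "component (reduce f - reduce g) p = 0" if "prime p" "odd p" for p
    using assms[OF that] that
    by (simp add: minus_prime_prod_def component_reduce cong_def mod_simps)
  then have "{p. prime p \<and> component (reduce f - reduce g) p \<noteq> 0} \<subseteq> {2}"
    using primes_dvd_imp_eq two_is_prime_nat by blast
  then show ?thesis
    unfolding \<A>.abs_eq_iff direct_sum_rel_def direct_sum_def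
    by (simp add: finite_subset)
qed

lemma to_\<A>_reduce_zero: "to_\<A> (reduce (\<lambda>_. 0)) = 0"
  by (simp add: zero_\<A>_def zero_prime_prod_def)

lemma to_\<A>_reduce_add: "to_\<A> (reduce (\<lambda>p. f p + g p)) = to_\<A> (reduce f) + to_\<A> (reduce g)"
proof -
  have "reduce (\<lambda>p. f p + g p) = reduce f + reduce g"
    by (rule prime_prod_eqI) (simp add: component_add component_reduce mod_simps)
  then show ?thesis
    by (simp add: plus_\<A>.abs_eq)
qed

lemma to_\<A>_reduce_uminus: "to_\<A> (reduce (\<lambda>p. - f p)) = - to_\<A> (reduce f)"
  using to_\<A>_reduce_add[of f "\<lambda>p. - f p"] to_\<A>_reduce_zero
  by (simp add: eq_neg_iff_add_eq_0 add.commute)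

lemma to_\<A>_reduce_of_int_mult:
  "to_\<A> (reduce (\<lambda>p. c * f p)) = of_int c * to_\<A> (reduce f)"
proof -
  have nat: "to_\<A> (reduce (\<lambda>p. int k * f p)) = of_nat k * to_\<A> (reduce f)" for k
    by (induction k) (simp_all add: to_\<A>_reduce_zero to_\<A>_reduce_add distrib_right)
  show ?thesis
    by (cases c rule: int_cases2) (simp_all add: nat to_\<A>_reduce_uminus)
qed

lemma to_\<A>_reduce_sum: "to_\<A> (reduce (\<lambda>p. \<Sum>i\<in>A. f i p)) = (\<Sum>i\<in>A. to_\<A> (reduce (f i)))"
  by (induction A rule: infinite_finite_induct) (simp_all add: to_\<A>_reduce_zero to_\<A>_reduce_add)

theorem corollary3p6:
  fixes a m :: nat
  assumes "even a" and "m \<le> a"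
  shows "(\<Sum>j = 0..a + 1.
            of_int (int ((a + 2) choose (m + 1)) - int ((a + 1 - j) choose (a - m + 1))) *
            T_\<A> (replicate j 1 @ [2] @ replicate (a + 1 - j) 1))
       = (- 1) ^ (m + 1) *
         (\<Sum>j = 0..a - m. T_\<A> (replicate j 1 @ [2] @ replicate (a + 1 - j) 1))"
proof -
  define c where "c j = int ((a + 2) choose (m + 1)) - int ((a + 1 - j) choose (a - m + 1))" for j
  define ks :: "nat \<Rightarrow> nat list"
    where "ks j = replicate j 1 @ [2] @ replicate (a + 1 - j) 1" for j
  have "[(\<Sum>j\<le>a + 1. c j * T_component (ks j) p) =
         (- 1) ^ (m + 1) * (\<Sum>j\<le>a - m. T_component (ks j) p)] (mod int p)"
    if "prime p" "odd p" for p
  proof -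
    interpret prime_modulus p
      by standard fact
    define x where "x j = \<phi> (Q (a + 1 - j) (Suc j))" for j
    have T: "[T_component (ks j) p = 2 ^ (a + 2) * x j] (mod int p)" if "j \<le> a + 1" for j
    proof -
      have "length (ks j) = a + 2"
        using that by (simp add: ks_def)
      then show ?thesis
        using T_component_cong[of "ks j"] \<open>odd p\<close> \<open>even a\<close>
        by (simp add: x_def ks_def iterated_hook[simplified])
    qed
    have "[(\<Sum>j\<le>a + 1. c j * T_component (ks j) p) =
        (\<Sum>j\<le>a + 1. c j * (2 ^ (a + 2) * x j))] (mod int p)"
      by (intro cong_sum cong_mult cong_refl T) simp
    also have "(\<Sum>j\<le>a + 1. c j * (2 ^ (a + 2) * x j)) = 2 ^ (a + 2) * (\<Sum>j\<le>a + 1. c j * x j)"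
      by (simp only: sum_distrib_left mult.left_commute)
    also have "[\<dots> = 2 ^ (a + 2) * ((- 1) ^ (m + 1) * (\<Sum>j\<le>a - m. x j))] (mod int p)"
      unfolding c_def x_def by (intro cong_mult cong_refl corollary_mod_p assms that)
    also have "2 ^ (a + 2) * ((- 1) ^ (m + 1) * (\<Sum>j\<le>a - m. x j)) =
        (- 1) ^ (m + 1) * (\<Sum>j\<le>a - m. 2 ^ (a + 2) * x j)"
      by (simp only: sum_distrib_left mult.left_commute)
    also have "[\<dots> = (- 1) ^ (m + 1) * (\<Sum>j\<le>a - m. T_component (ks j) p)] (mod int p)"
      by (intro cong_mult cong_refl cong_sum cong_sym[OF T]) auto
    finally show ?thesis .
  qed
  then have "to_\<A> (reduce (\<lambda>p. \<Sum>j\<le>a + 1. c j * T_component (ks j) p)) =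
      to_\<A> (reduce (\<lambda>p. (- 1) ^ (m + 1) * (\<Sum>j\<le>a - m. T_component (ks j) p)))"
    by (rule to_\<A>_reduce_cong)
  then have "(\<Sum>j\<le>a + 1. of_int (c j) * T_\<A> (ks j)) = (- 1) ^ (m + 1) * (\<Sum>j\<le>a - m. T_\<A> (ks j))"
    unfolding to_\<A>_reduce_sum to_\<A>_reduce_of_int_mult T_\<A>_def[symmetric] by simp
  then show ?thesis
    unfolding c_def ks_def atMost_atLeast0 .
qed

end
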